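(* Let $\Sigma$ be a finite FL-closed set of $\mu_c\mathsf{ML}$-formulas and let $\mathbb{S}=(S,R,V)$ be a Kripke model. For every filtration $\overline{\mathbb{S}}=(\overline S,\overline R,\overline V)$ of $\mathbb{S}$ through $\Sigma$, every state $s\in S$ and every clean formula $\xi\in\Sigma$, \[\mathbb{S},s\Vdash\xi \iff \overline{\mathbb{S}},\overline s\Vdash \xi,\] where $\overline s$ is the equivalence class of $s$.
   Context: Fix a countably infinite set $\mathsf{P}$ of propositional variables. The languages $\mu_c\mathsf{ML}$ (continuous modal $\mu$-calculus), $\mathsf{Con}_X$ and $\mathsf{Cocon}_X$ (for $X\subseteq\mathsf P$) are defined by simultaneous induction: $\mu_c\mathsf{ML}$: $\varphi ::= p \mid \neg p\mid \varphi\lor\varphi\mid\varphi\land\varphi\mid \Diamond\varphi\mid\Box\varphi\mid \mu x.\varphi'\mid \nu x.\varphi''$ with $p,x\in\mathsf P$, $\varphi'\in\mathsf{Con}_{\{x\}}$, $\varphi''\in\mathsf{Cocon}_{\{x\}}$; $\mathsf{Con}_X$: $\varphi::= x\mid\alpha\mid\varphi\lor\varphi\mid\varphi\land\varphi\mid\Diamond\varphi\mid\mu y.\varphi'$ with $x\in X$, $\alpha\in\mu_c\mathsf{ML}$ containing no variable of $X$ free, $\varphi'\in\mathsf{Con}_{X\cup\{y\}}$; $\mathsf{Cocon}_X$: $\varphi::= x\mid\alpha\mid\varphi\lor\varphi\mid\varphi\land\varphi\mid\Box\varphi\mid\nu y.\varphi'$ with $x\in X$, $\alpha$ $X$-free,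 $\varphi'\in\mathsf{Cocon}_{X\cup\{y\}}$. A formula is tidy if its sets of free and bound variables are disjoint; all formulas are assumed tidy. A formula is clean if it is tidy and each bound variable $x$ is bound by a unique subformula occurrence $\eta x.\delta_x$. Semantics: a Kripke model $\mathbb S=(S,R,V)$ has $R\subseteq S\times S$ and $V:\mathsf P\to\mathcal P(S)$; $[\![\cdot]\!]^{\mathbb S}$ is as usual for literals, Boolean and modal connectives, and $[\![\mu x.\varphi]\!]=\bigcap\{X: [\![\varphi]\!]^{\mathbb S[x\mapsto X]}\subseteq X\}$, $[\![\nu x.\varphi]\!]=\bigcup\{X: X\subseteq[\![\varphi]\!]^{\mathbb S[x\mapsto X]}\}$. $\mathbb S,s\Vdash\varphi$ means $s\in[\![\varphi]\!]^{\mathbb S}$. The FL-closure of a set $\Phi$ is the least $\Psi\supseteq\Phi$ such that: $\neg p\in\Psi\Rightarrow p\in\Psi$; $\varphi\circ\psi\in\Psi\Rightarrow\varphi,\psi\in\Psi$ for $\circ\in\{\lor,\land\}$; $\heartsuit\varphi\in\Psi\Rightarrow\varphi\in\Psi$ for $\heartsuit\in\{\Diamond,\Box\}$; $\eta x.\varphi\in\Psi\Rightarrow\varphi[\eta x.\varphi/x]\in\Psi$ (capture-avoiding substitution). $\Sigma$ is FL-closed if it equals its FL-closure. Filtration: for $\Sigma$ finite FL-closed, let $s\sim_\Sigma s'$ iff $s,s'$ satisfy the same formulas of $\Sigma$. A filtration of $\mathbb S$ through $\Sigma$ is a model $(S^\Sigma,R^\Sigma,V^\Sigma)$ with $S^\Sigma=S/{\sim_\Sigma}$;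 $R^{\min}\subseteq R^\Sigma\subseteq R^{\max}$, where $\overline s R^{\min}\overline t$ iff $Rs't'$ for some $s'\sim_\Sigma s$, $t'\sim_\Sigma t$, and $\overline sR^{\max}\overline t$ iff for all $\Box\varphi\in\Sigma$, $s\Vdash\Box\varphi$ implies $t\Vdash\varphi$; and $V^\Sigma(p)=\{\overline s: s\Vdash p\}$ for every propositional variable $p\in\Sigma$.
   Formalization: R^max also requires: for all ◇φ∈Σ, t⊩φ implies s⊩◇φ. With the □ clause alone the claim fails: Σ={◇p,p}, two states, R=∅, p true at exactly one; R^max is total, so ◇p holds at every class but at no state. *)

theory Defs
  imports Main "HOL-Library.Countable" "HOL-Library.Infinite_Typeclass"
begin

section \<open>Syntax\<close>

text \<open>Raw formulas in negation normal form. The restrictions on fixpoint bodies are imposed by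
  the inductive predicates below, not by the datatype.\<close>

datatype 'p fm =
    Var 'p
  | NVar 'p
  | Or "'p fm" "'p fm"
  | And "'p fm" "'p fm"
  | Dia "'p fm"
  | Box "'p fm"
  | Mu 'p "'p fm"
  | Nu 'p "'p fm"

primrec fv :: "'p fm \<Rightarrow> 'p set" where
  "fv (Var p) = {p}"
| "fv (NVar p) = {p}"
| "fv (Or \<phi> \<psi>) = fv \<phi> \<union> fv \<psi>"
| "fv (And \<phi> \<psi>) = fv \<phi> \<union> fv \<psi>"
| "fv (Dia \<phi>) = fv \<phi>"
| "fv (Box \<phi>) = fv \<phi>"
| "fv (Mu x \<phi>) = fv \<phi> - {x}"
| "fv (Nu x \<phi>) = fv \<phi> - {x}"

primrec bv :: "'p fm \<Rightarrow> 'p set" where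
  "bv (Var p) = {}"
| "bv (NVar p) = {}"
| "bv (Or \<phi> \<psi>) = bv \<phi> \<union> bv \<psi>"
| "bv (And \<phi> \<psi>) = bv \<phi> \<union> bv \<psi>"
| "bv (Dia \<phi>) = bv \<phi>"
| "bv (Box \<phi>) = bv \<phi>"
| "bv (Mu x \<phi>) = insert x (bv \<phi>)"
| "bv (Nu x \<phi>) = insert x (bv \<phi>)"

text \<open>The number of occurrences in a formula of subformulas of the form
  \<open>Mu x \<delta>\<close> or \<open>Nu x \<delta>\<close>, for a given \<open>x\<close>.\<close>

primrec binders :: "'p \<Rightarrow> 'p fm \<Rightarrow> nat" where
  "binders x (Var p) = 0"
| "binders x (NVar p) = 0"
| "binders x (Or \<phi> \<psi>) = binders x \<phi> + binders x \<psi>"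
| "binders x (And \<phi> \<psi>) = binders x \<phi> + binders x \<psi>"
| "binders x (Dia \<phi>) = binders x \<phi>"
| "binders x (Box \<phi>) = binders x \<phi>"
| "binders x (Mu y \<phi>) = (if x = y then 1 else 0) + binders x \<phi>"
| "binders x (Nu y \<phi>) = (if x = y then 1 else 0) + binders x \<phi>"

definition tidy :: "'p fm \<Rightarrow> bool" where
  "tidy \<phi> \<longleftrightarrow> fv \<phi> \<inter> bv \<phi> = {}"

definition clean :: "'p fm \<Rightarrow> bool" where
  "clean \<phi> \<longleftrightarrow> tidy \<phi> \<and> (\<forall>x\<in>bv \<phi>. binders x \<phi> = 1)"

inductive mucML :: "'p fm \<Rightarrow> bool"
  and Con :: "'p set \<Rightarrow> 'p fm \<Rightarrow> bool"
  and Cocon :: "'p set \<Rightarrow> 'p fm \<Rightarrow> bool" where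
  mucML_Var: "mucML (Var p)"
| mucML_NVar: "mucML (NVar p)"
| mucML_Or: "mucML \<phi> \<Longrightarrow> mucML \<psi> \<Longrightarrow> mucML (Or \<phi> \<psi>)"
| mucML_And: "mucML \<phi> \<Longrightarrow> mucML \<psi> \<Longrightarrow> mucML (And \<phi> \<psi>)"
| mucML_Dia: "mucML \<phi> \<Longrightarrow> mucML (Dia \<phi>)"
| mucML_Box: "mucML \<phi> \<Longrightarrow> mucML (Box \<phi>)"
| mucML_Mu: "Con {x} \<phi> \<Longrightarrow> mucML (Mu x \<phi>)"
| mucML_Nu: "Cocon {x} \<phi> \<Longrightarrow> mucML (Nu x \<phi>)"
| Con_Var: "x \<in> X \<Longrightarrow> Con X (Var x)"
| Con_free: "mucML \<alpha> \<Longrightarrow> fv \<alpha> \<inter> X = {} \<Longrightarrow> Con X \<alpha>"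
| Con_Or: "Con X \<phi> \<Longrightarrow> Con X \<psi> \<Longrightarrow> Con X (Or \<phi> \<psi>)"
| Con_And: "Con X \<phi> \<Longrightarrow> Con X \<psi> \<Longrightarrow> Con X (And \<phi> \<psi>)"
| Con_Dia: "Con X \<phi> \<Longrightarrow> Con X (Dia \<phi>)"
| Con_Mu: "Con (X \<union> {y}) \<phi> \<Longrightarrow> Con X (Mu y \<phi>)"
| Cocon_Var: "x \<in> X \<Longrightarrow> Cocon X (Var x)"
| Cocon_free: "mucML \<alpha> \<Longrightarrow> fv \<alpha> \<inter> X = {} \<Longrightarrow> Cocon X \<alpha>"
| Cocon_Or: "Cocon X \<phi> \<Longrightarrow> Cocon X \<psi> \<Longrightarrow> Cocon X (Or \<phi> \<psi>)"
| Cocon_And: "Cocon X \<phi> \<Longrightarrow> Cocon X \<psi> \<Longrightarrow> Cocon X (And \<phi> \<psi>)"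
| Cocon_Box: "Cocon X \<phi> \<Longrightarrow> Cocon X (Box \<phi>)"
| Cocon_Nu: "Cocon (X \<union> {y}) \<phi> \<Longrightarrow> Cocon X (Nu y \<phi>)"

section \<open>Substitution and Fischer-Ladner closure\<close>

text \<open>Replacement of the free positive occurrences of \<open>x\<close> in a formula by \<open>\<theta>\<close>, without
  renaming. For the only instances used, the unfoldings of tidy fixpoint formulas of \<open>mucML\<close>,
  this is capture-avoiding substitution: see \<open>unfold_Mu\<close> and \<open>unfold_Nu\<close> below.\<close>

primrec subst :: "'p fm \<Rightarrow> 'p \<Rightarrow> 'p fm \<Rightarrow> 'p fm" where
  "subst \<theta> x (Var p) = (if p = x then \<theta> else Var p)"
| "subst \<theta> x (NVar p) = NVar p"
| "subst \<theta> x (Or \<phi> \<psi>) = Or (subst \<theta> x \<phi>) (subst \<theta> x \<psi>)"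
| "subst \<theta> x (And \<phi> \<psi>) = And (subst \<theta> x \<phi>) (subst \<theta> x \<psi>)"
| "subst \<theta> x (Dia \<phi>) = Dia (subst \<theta> x \<phi>)"
| "subst \<theta> x (Box \<phi>) = Box (subst \<theta> x \<phi>)"
| "subst \<theta> x (Mu y \<phi>) = (if y = x then Mu y \<phi> else Mu y (subst \<theta> x \<phi>))"
| "subst \<theta> x (Nu y \<phi>) = (if y = x then Nu y \<phi> else Nu y (subst \<theta> x \<phi>))"

text \<open>No free occurrence of \<open>x\<close> is negated or lies in the scope of a binder of a variable
  in \<open>Y\<close>.\<close>

primrec free_for :: "'p set \<Rightarrow> 'p \<Rightarrow> 'p fm \<Rightarrow> bool" where
  "free_for Y x (Var p) = True"
| "free_for Y x (NVar p) = (p \<noteq> x)"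
| "free_for Y x (Or \<phi> \<psi>) = (free_for Y x \<phi> \<and> free_for Y x \<psi>)"
| "free_for Y x (And \<phi> \<psi>) = (free_for Y x \<phi> \<and> free_for Y x \<psi>)"
| "free_for Y x (Dia \<phi>) = free_for Y x \<phi>"
| "free_for Y x (Box \<phi>) = free_for Y x \<phi>"
| "free_for Y x (Mu y \<phi>) = (x \<in> fv (Mu y \<phi>) \<longrightarrow> y \<notin> Y \<and> free_for Y x \<phi>)"
| "free_for Y x (Nu y \<phi>) = (x \<in> fv (Nu y \<phi>) \<longrightarrow> y \<notin> Y \<and> free_for Y x \<phi>)"

lemma free_for_notin_fv: "x \<notin> fv \<phi> \<Longrightarrow> free_for Y x \<phi>"
  by (induction \<phi>) auto

lemma free_for_Con_Cocon:
  "mucML \<phi> \<Longrightarrow> True"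
  "Con X \<phi> \<Longrightarrow> x \<in> X \<Longrightarrow> bv \<phi> \<inter> Y = {} \<Longrightarrow> free_for Y x \<phi>"
  "Cocon X \<phi> \<Longrightarrow> x \<in> X \<Longrightarrow> bv \<phi> \<inter> Y = {} \<Longrightarrow> free_for Y x \<phi>"
  by (induction rule: mucML_Con_Cocon.inducts) (auto intro: free_for_notin_fv)

lemma unfold_Mu:
  assumes "mucML (Mu x \<phi>)" "tidy (Mu x \<phi>)"
  shows "free_for (fv (Mu x \<phi>)) x \<phi>"
proof -
  have "Con {x} \<phi>"
    using assms(1) by (cases rule: mucML.cases) auto
  then show ?thesis
    using assms(2) by (intro free_for_Con_Cocon(2)) (auto simp: tidy_def)
qed

lemma unfold_Nu:
  assumes "mucML (Nu x \<phi>)" "tidy (Nu x \<phi>)"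
  shows "free_for (fv (Nu x \<phi>)) x \<phi>"
proof -
  have "Cocon {x} \<phi>"
    using assms(1) by (cases rule: mucML.cases) auto
  then show ?thesis
    using assms(2) by (intro free_for_Con_Cocon(3)) (auto simp: tidy_def)
qed

inductive_set FL :: "'p fm set \<Rightarrow> 'p fm set" for \<Phi> :: "'p fm set" where
  FL_base: "\<phi> \<in> \<Phi> \<Longrightarrow> \<phi> \<in> FL \<Phi>"
| FL_NVar: "NVar p \<in> FL \<Phi> \<Longrightarrow> Var p \<in> FL \<Phi>"
| FL_Or1: "Or \<phi> \<psi> \<in> FL \<Phi> \<Longrightarrow> \<phi> \<in> FL \<Phi>"
| FL_Or2: "Or \<phi> \<psi> \<in> FL \<Phi> \<Longrightarrow> \<psi> \<in> FL \<Phi>"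
| FL_And1: "And \<phi> \<psi> \<in> FL \<Phi> \<Longrightarrow> \<phi> \<in> FL \<Phi>"
| FL_And2: "And \<phi> \<psi> \<in> FL \<Phi> \<Longrightarrow> \<psi> \<in> FL \<Phi>"
| FL_Dia: "Dia \<phi> \<in> FL \<Phi> \<Longrightarrow> \<phi> \<in> FL \<Phi>"
| FL_Box: "Box \<phi> \<in> FL \<Phi> \<Longrightarrow> \<phi> \<in> FL \<Phi>"
| FL_Mu: "Mu x \<phi> \<in> FL \<Phi> \<Longrightarrow> subst (Mu x \<phi>) x \<phi> \<in> FL \<Phi>"
| FL_Nu: "Nu x \<phi> \<in> FL \<Phi> \<Longrightarrow> subst (Nu x \<phi>) x \<phi> \<in> FL \<Phi>"

definition FL_closed :: "'p fm set \<Rightarrow> bool" where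
  "FL_closed \<Sigma> \<longleftrightarrow> FL \<Sigma> = \<Sigma>"

section \<open>Semantics\<close>

record ('a, 'p) kripke =
  states :: "'a set"
  rel :: "('a \<times> 'a) set"
  val :: "'p \<Rightarrow> 'a set"

definition kripke_model :: "('a, 'p) kripke \<Rightarrow> bool" where
  "kripke_model M \<longleftrightarrow> rel M \<subseteq> states M \<times> states M \<and> (\<forall>p. val M p \<subseteq> states M)"

definition upd :: "('a, 'p) kripke \<Rightarrow> 'p \<Rightarrow> 'a set \<Rightarrow> ('a, 'p) kripke" where
  "upd M x X = M\<lparr>val := (val M)(x := X)\<rparr>"

primrec sem :: "'p fm \<Rightarrow> ('a, 'p) kripke \<Rightarrow> 'a set" where
  "sem (Var p) M = val M p"
| "sem (NVar p) M = states M - val M p"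
| "sem (Or \<phi> \<psi>) M = sem \<phi> M \<union> sem \<psi> M"
| "sem (And \<phi> \<psi>) M = sem \<phi> M \<inter> sem \<psi> M"
| "sem (Dia \<phi>) M = {s \<in> states M. \<exists>t. (s, t) \<in> rel M \<and> t \<in> sem \<phi> M}"
| "sem (Box \<phi>) M = {s \<in> states M. \<forall>t. (s, t) \<in> rel M \<longrightarrow> t \<in> sem \<phi> M}"
| "sem (Mu x \<phi>) M = \<Inter>{X. X \<subseteq> states M \<and> sem \<phi> (upd M x X) \<subseteq> X}"
| "sem (Nu x \<phi>) M = \<Union>{X. X \<subseteq> states M \<and> X \<subseteq> sem \<phi> (upd M x X)}"

definition sat :: "('a, 'p) kripke \<Rightarrow> 'a \<Rightarrow> 'p fm \<Rightarrow> bool" where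
  "sat M s \<phi> \<longleftrightarrow> s \<in> sem \<phi> M"

section \<open>Filtrations\<close>

definition filt_eq :: "'p fm set \<Rightarrow> ('a, 'p) kripke \<Rightarrow> ('a \<times> 'a) set" where
  "filt_eq \<Sigma> M =
     {(s, t). s \<in> states M \<and> t \<in> states M \<and> (\<forall>\<phi>\<in>\<Sigma>. sat M s \<phi> \<longleftrightarrow> sat M t \<phi>)}"

definition filt_class :: "'p fm set \<Rightarrow> ('a, 'p) kripke \<Rightarrow> 'a \<Rightarrow> 'a set" where
  "filt_class \<Sigma> M s = filt_eq \<Sigma> M `` {s}"

definition filt_min :: "'p fm set \<Rightarrow> ('a, 'p) kripke \<Rightarrow> ('a set \<times> 'a set) set" where
  "filt_min \<Sigma> M =
     {(filt_class \<Sigma> M s, filt_class \<Sigma> M t) | s t. s \<in> states M \<and> t \<in> states M \<and>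
        (\<exists>s' t'. (s, s') \<in> filt_eq \<Sigma> M \<and> (t, t') \<in> filt_eq \<Sigma> M \<and> (s', t') \<in> rel M)}"

text \<open>The maximal relation has one clause for each modality. As \<open>\<Sigma>\<close> consists of formulas in
  negation normal form and need not be closed under (dual) negation, the clause for \<open>Dia\<close> does
  not follow from the one for \<open>Box\<close>, and without it filtrations need not preserve \<open>Dia\<close>
  formulas. If \<open>\<Sigma>\<close> is closed under dual negation, then the two clauses are equivalent.
  For \<open>FL_closed \<Sigma>\<close> the conditions do not depend on the choice of representatives.\<close>

definition filt_max :: "'p fm set \<Rightarrow> ('a, 'p) kripke \<Rightarrow> ('a set \<times> 'a set) set" where
  "filt_max \<Sigma> M =
     {(filt_class \<Sigma> M s, filt_class \<Sigma> M t) | s t. s \<in> states M \<and> t \<in> states M \<and>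
        (\<forall>\<phi>. Box \<phi> \<in> \<Sigma> \<longrightarrow> sat M s (Box \<phi>) \<longrightarrow> sat M t \<phi>) \<and>
        (\<forall>\<phi>. Dia \<phi> \<in> \<Sigma> \<longrightarrow> sat M t \<phi> \<longrightarrow> sat M s (Dia \<phi>))}"

text \<open>The valuation of variables outside \<open>\<Sigma>\<close> is arbitrary.\<close>

definition filtration ::
  "'p fm set \<Rightarrow> ('a, 'p) kripke \<Rightarrow> ('a set, 'p) kripke \<Rightarrow> bool" where
  "filtration \<Sigma> M N \<longleftrightarrow>
     kripke_model N \<and>
     states N = states M // filt_eq \<Sigma> M \<and>
     filt_min \<Sigma> M \<subseteq> rel N \<and> rel N \<subseteq> filt_max \<Sigma> M \<and>
     (\<forall>p. Var p \<in> \<Sigma> \<longrightarrow>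
        val N p = {filt_class \<Sigma> M s | s. s \<in> states M \<and> sat M s (Var p)})"

end

theory Submission
  imports Defs
begin

text \<open>Truth is transferred from \<open>M\<close> to \<open>N\<close> by induction on the grammar. Under a least fixpoint
  the active variables occur only in the scope of disjunctions, conjunctions and diamonds, and
  diamonds are preserved by any homomorphism; so least fixpoints transfer by Park induction
  on the preimage of a prefixpoint of \<open>N\<close>. Under a greatest fixpoint boxes are needed, and they
  are preserved for the formulas of \<open>\<Sigma>\<close> only: there the active variables are replaced by the
  fixpoint formulas that bind them, whose truth sets in \<open>M\<close> have postfixpoints of \<open>N\<close> as images.
  Falsity is transferred by duality: swapping the connectives but keeping the literals turns truth
  into falsity in the model with the complementary valuation, and turns filtrations into
  filtrations.\<close>

section \<open>Semantics and substitution\<close>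

lemma upd_simps [simp]:
  "states (upd M x X) = states M"
  "rel (upd M x X) = rel M"
  "val (upd M x X) = (val M)(x := X)"
  by (simp_all add: upd_def)

lemma upd_upd [simp]: "upd (upd M x X) x Y = upd M x Y"
  by (simp add: upd_def)

lemma upd_commute: "x \<noteq> y \<Longrightarrow> upd (upd M x X) y Y = upd (upd M y Y) x X"
  by (simp add: upd_def fun_upd_twist)

lemma kripke_model_upd: "kripke_model M \<Longrightarrow> X \<subseteq> states M \<Longrightarrow> kripke_model (upd M x X)"
  by (simp add: kripke_model_def)

lemma sem_cong:
  assumes "states M = states M'" "rel M = rel M'" "\<And>p. p \<in> fv \<phi> \<Longrightarrow> val M p = val M' p"
  shows "sem \<phi> M = sem \<phi> M'"
  using assms
proof (induction \<phi> arbitrary: M M')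
  case (Or \<phi> \<psi>)
  have "sem \<phi> M = sem \<phi> M'"
    using Or.prems by (intro Or.IH(1)) simp_all
  moreover have "sem \<psi> M = sem \<psi> M'"
    using Or.prems by (intro Or.IH(2)) simp_all
  ultimately show ?case by simp
next
  case (And \<phi> \<psi>)
  have "sem \<phi> M = sem \<phi> M'"
    using And.prems by (intro And.IH(1)) simp_all
  moreover have "sem \<psi> M = sem \<psi> M'"
    using And.prems by (intro And.IH(2)) simp_all
  ultimately show ?case by simp
next
  case (Dia \<phi>)
  have "sem \<phi> M = sem \<phi> M'"
    using Dia.prems by (intro Dia.IH) simp_all
  then show ?case using Dia.prems by simp
next
  case (Box \<phi>)
  have "sem \<phi> M = sem \<phi> M'"
    using Box.prems by (intro Box.IH) simp_all
  then show ?case using Box.prems by simp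
next
  case (Mu x \<phi>)
  have "sem \<phi> (upd M x X) = sem \<phi> (upd M' x X)" for X
    using Mu.prems by (intro Mu.IH) auto
  then show ?case using Mu.prems by simp
next
  case (Nu x \<phi>)
  have "sem \<phi> (upd M x X) = sem \<phi> (upd M' x X)" for X
    using Nu.prems by (intro Nu.IH) auto
  then show ?case using Nu.prems by simp
qed auto

lemma sem_upd_notin: "x \<notin> fv \<phi> \<Longrightarrow> sem \<phi> (upd M x X) = sem \<phi> M"
  by (rule sem_cong) auto

lemma sem_subset_states: "kripke_model M \<Longrightarrow> sem \<phi> M \<subseteq> states M"
proof (induction \<phi> arbitrary: M)
  case (Mu x \<phi>)
  \<comment> \<open>The whole state set is a prefixpoint, so the intersection defining
    \<open>Mu\<close> is over a nonempty family and stays inside \<open>states M\<close>.\<close>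
  have "sem \<phi> (upd M x (states M)) \<subseteq> states M"
    using Mu.IH[OF kripke_model_upd[OF Mu.prems order_refl]] by simp
  then show ?case by auto
next
  case (Or \<phi> \<psi>)
  then show ?case by simp
next
  case (And \<phi> \<psi>)
  then show ?case by (simp add: le_infI1)
qed (auto simp: kripke_model_def)

text \<open>\<open>free_for\<close> rules out negated free occurrences of \<open>x\<close>, the only
  source of antitone behaviour.\<close>

lemma sem_upd_mono:
  assumes "free_for Y x \<phi>" "A \<subseteq> B"
  shows "sem \<phi> (upd M x A) \<subseteq> sem \<phi> (upd M x B)"
  using assms(1)
proof (induction \<phi> arbitrary: M)
  case (Mu y \<phi>)
  show ?case
  proof (cases "x \<in> fv (Mu y \<phi>)")
    case True
    then have "x \<noteq> y" "free_for Y x \<phi>"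
      using Mu.prems by auto
    then have "sem \<phi> (upd (upd M x A) y X) \<subseteq> sem \<phi> (upd (upd M x B) y X)" for X
      using Mu.IH by (simp add: upd_commute[of x y])
    \<comment> \<open>A larger value of \<open>x\<close> leaves fewer prefixpoints, so their
      intersection grows.\<close>
    from order_trans[OF this] order_trans[OF _ this] show ?thesis
      unfolding sem.simps upd_simps by (intro Inter_anti_mono Collect_mono impI conjI) simp_all
  next
    case False
    then show ?thesis by (simp add: sem_upd_notin del: sem.simps fv.simps)
  qed
next
  case (Nu y \<phi>)
  show ?case
  proof (cases "x \<in> fv (Nu y \<phi>)")
    case True
    then have "x \<noteq> y" "free_for Y x \<phi>"
      using Nu.prems by auto
    then have "sem \<phi> (upd (upd M x A) y X) \<subseteq> sem \<phi> (upd (upd M x B) y X)" for X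
      using Nu.IH by (simp add: upd_commute[of x y])
    from order_trans[OF this] order_trans[OF _ this] show ?thesis
      unfolding sem.simps upd_simps by (intro Union_mono Collect_mono impI conjI) simp_all
  next
    case False
    then show ?thesis by (simp add: sem_upd_notin del: sem.simps fv.simps)
  qed
next
  case (Or \<phi> \<psi>)
  then show ?case by (simp add: le_supI1 le_supI2)
next
  case (And \<phi> \<psi>)
  then show ?case by (simp add: le_infI1 le_infI2)
qed (use assms(2) in auto)

section \<open>Substitution as a change of valuation\<close>

lemma subst_notin: "x \<notin> fv \<phi> \<Longrightarrow> subst \<theta> x \<phi> = \<phi>"
  by (induction \<phi>) auto

text \<open>At a binder \<open>y\<close> with \<open>x\<close> free in its scope, the hypothesis
  gives \<open>y \<notin> fv \<theta>\<close>, so updating \<open>y\<close> leaves the truth set of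
  \<theta> unchanged; \<open>x \<noteq> y\<close> lets the two updates commute.\<close>

lemma sem_subst:
  assumes "free_for (fv \<theta>) x \<phi>"
  shows "sem (subst \<theta> x \<phi>) M = sem \<phi> (upd M x (sem \<theta> M))"
  using assms
proof (induction \<phi> arbitrary: M)
  case (Mu y \<phi>)
  show ?case
  proof (cases "x \<in> fv (Mu y \<phi>)")
    case True
    then have "x \<noteq> y" "free_for (fv \<theta>) x \<phi>" "y \<notin> fv \<theta>"
      using Mu.prems by auto
    then show ?thesis
      using Mu.IH by (simp add: upd_commute[of x y] sem_upd_notin)
  next
    case False
    then show ?thesis by (simp add: subst_notin sem_upd_notin del: subst.simps sem.simps fv.simps)
  qed
next
  case (Nu y \<phi>)
  show ?case
  proof (cases "x \<in> fv (Nu y \<phi>)")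
    case True
    then have "x \<noteq> y" "free_for (fv \<theta>) x \<phi>" "y \<notin> fv \<theta>"
      using Nu.prems by auto
    then show ?thesis
      using Nu.IH by (simp add: upd_commute[of x y] sem_upd_notin)
  next
    case False
    then show ?thesis by (simp add: subst_notin sem_upd_notin del: subst.simps sem.simps fv.simps)
  qed
qed simp_all

text \<open>One half of Knaster-Tarski: every postfixpoint lies below the union of all of them,
  hence by monotonicity below the body evaluated at that union.\<close>

lemma sem_Nu_unfold:
  assumes "mucML (Nu x \<phi>)" "tidy (Nu x \<phi>)"
  shows "sem (Nu x \<phi>) M \<subseteq> sem (subst (Nu x \<phi>) x \<phi>) M"
proof -
  note free = unfold_Nu[OF assms]
  have "X \<subseteq> sem \<phi> (upd M x (sem (Nu x \<phi>) M))"
    if "X \<subseteq> states M" "X \<subseteq> sem \<phi> (upd M x X)" for X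
  proof -
    have "X \<subseteq> sem (Nu x \<phi>) M"
      using that by auto
    from sem_upd_mono[OF free this] that(2) show ?thesis by blast
  qed
  then show ?thesis
    unfolding sem_subst[OF free] by (subst sem.simps(8)) (intro Union_least, blast)
qed

section \<open>Simultaneous substitution\<close>

text \<open>As in \<open>subst\<close>, negated occurrences are left alone; the active variables \<open>X\<close> never occur
  negated in formulas of \<open>Con X\<close> and \<open>Cocon X\<close>.\<close>

primrec msubst :: "('p \<Rightarrow> 'p fm) \<Rightarrow> 'p fm \<Rightarrow> 'p fm" where
  "msubst \<sigma> (Var p) = \<sigma> p"
| "msubst \<sigma> (NVar p) = NVar p"
| "msubst \<sigma> (Or \<phi> \<psi>) = Or (msubst \<sigma> \<phi>) (msubst \<sigma> \<psi>)"
| "msubst \<sigma> (And \<phi> \<psi>) = And (msubst \<sigma> \<phi>) (msubst \<sigma> \<psi>)"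
| "msubst \<sigma> (Dia \<phi>) = Dia (msubst \<sigma> \<phi>)"
| "msubst \<sigma> (Box \<phi>) = Box (msubst \<sigma> \<phi>)"
| "msubst \<sigma> (Mu x \<phi>) = Mu x (msubst (\<sigma>(x := Var x)) \<phi>)"
| "msubst \<sigma> (Nu x \<phi>) = Nu x (msubst (\<sigma>(x := Var x)) \<phi>)"

lemma msubst_ident: "(\<And>z. z \<in> fv \<phi> \<Longrightarrow> \<sigma> z = Var z) \<Longrightarrow> msubst \<sigma> \<phi> = \<phi>"
  by (induction \<phi> arbitrary: \<sigma>) auto

text \<open>Used to see that unfolding a substituted fixpoint formula gives a substitution instance
  of the original body. The hypothesis keeps the second substitution away from the formulas inserted
  by the first.\<close>

lemma subst_msubst:
  assumes "\<And>z. z \<in> fv \<phi> \<Longrightarrow> z \<noteq> x \<Longrightarrow> x \<notin> fv (\<sigma> z)"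
  shows "subst \<theta> x (msubst (\<sigma>(x := Var x)) \<phi>) = msubst (\<sigma>(x := \<theta>)) \<phi>"
  using assms
proof (induction \<phi> arbitrary: \<sigma>)
  case (Mu y \<phi>)
  show ?case
  proof (cases "y = x")
    case False
    have "subst \<theta> x (msubst ((\<sigma>(y := Var y))(x := Var x)) \<phi>) = msubst ((\<sigma>(y := Var y))(x := \<theta>)) \<phi>"
      using False Mu.prems by (intro Mu.IH) auto
    with False show ?thesis by (simp add: fun_upd_twist[OF False] del: fun_upd_apply)
  qed (simp del: fun_upd_apply)
next
  case (Nu y \<phi>)
  show ?case
  proof (cases "y = x")
    case False
    have "subst \<theta> x (msubst ((\<sigma>(y := Var y))(x := Var x)) \<phi>) = msubst ((\<sigma>(y := Var y))(x := \<theta>)) \<phi>"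
      using False Nu.prems by (intro Nu.IH) auto
    with False show ?thesis by (simp add: fun_upd_twist[OF False] del: fun_upd_apply)
  qed (simp del: fun_upd_apply)
qed (auto simp: subst_notin)

text \<open>A free negated \<open>z\<close> survives \<open>msubst\<close>; the hypothesis makes
  \<sigma> fix every such variable, so \<open>z\<close> still appears in
  \<open>fv (\<sigma> z)\<close>.\<close>

lemma fv_msubst:
  assumes "\<And>z. free_for {} z \<phi> \<or> \<sigma> z = Var z"
  shows "fv (msubst \<sigma> \<phi>) \<subseteq> (\<Union>z\<in>fv \<phi>. fv (\<sigma> z))"
  using assms
proof (induction \<phi> arbitrary: \<sigma>)
  case (NVar p)
  then show ?case using NVar[of p] by auto
next
  case (Or \<phi> \<psi>)
  have "fv (msubst \<sigma> \<phi>) \<subseteq> (\<Union>z\<in>fv \<phi>. fv (\<sigma> z))"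
    using Or.prems by (intro Or.IH(1)) auto
  moreover have "fv (msubst \<sigma> \<psi>) \<subseteq> (\<Union>z\<in>fv \<psi>. fv (\<sigma> z))"
    using Or.prems by (intro Or.IH(2)) auto
  ultimately show ?case by auto
next
  case (And \<phi> \<psi>)
  have "fv (msubst \<sigma> \<phi>) \<subseteq> (\<Union>z\<in>fv \<phi>. fv (\<sigma> z))"
    using And.prems by (intro And.IH(1)) auto
  moreover have "fv (msubst \<sigma> \<psi>) \<subseteq> (\<Union>z\<in>fv \<psi>. fv (\<sigma> z))"
    using And.prems by (intro And.IH(2)) auto
  ultimately show ?case by auto
next
  case (Mu y \<phi>)
  have "free_for {} z \<phi> \<or> (\<sigma>(y := Var y)) z = Var z" for z
    using Mu.prems[of z] free_for_notin_fv[of z \<phi>] by auto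
  from Mu.IH[of "\<sigma>(y := Var y)", OF this]
  have "fv (msubst (\<sigma>(y := Var y)) \<phi>) - {y} \<subseteq> (\<Union>z\<in>fv \<phi> - {y}. fv (\<sigma> z))"
    by (auto simp del: fun_upd_apply dest!: subsetD) (auto split: if_splits)
  then show ?case by simp
next
  case (Nu y \<phi>)
  have "free_for {} z \<phi> \<or> (\<sigma>(y := Var y)) z = Var z" for z
    using Nu.prems[of z] free_for_notin_fv[of z \<phi>] by auto
  from Nu.IH[of "\<sigma>(y := Var y)", OF this]
  have "fv (msubst (\<sigma>(y := Var y)) \<phi>) - {y} \<subseteq> (\<Union>z\<in>fv \<phi> - {y}. fv (\<sigma> z))"
    by (auto simp del: fun_upd_apply dest!: subsetD) (auto split: if_splits)
  then show ?case by simp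
qed simp_all

text \<open>A capture condition, which for \<open>\<sigma> = Var\<close> is tidiness. It is the
  invariant that takes over once bound variables have become active.\<close>

definition msubst_safe :: "'p set \<Rightarrow> ('p \<Rightarrow> 'p fm) \<Rightarrow> 'p fm \<Rightarrow> bool" where
  "msubst_safe X \<sigma> \<phi> \<longleftrightarrow> (\<forall>z. z \<notin> X \<longrightarrow> \<sigma> z = Var z) \<and> bv \<phi> \<inter> (\<Union>z\<in>fv \<phi>. fv (\<sigma> z)) = {}"

text \<open>Descends below a binder: \<open>y\<close> becomes active and stands for the substituted
  fixpoint formula \<theta>, whose free variables come from formulas already known to avoid
  \<open>bv \<phi>\<close>. As \<theta> is constrained through \<open>fv \<theta>\<close> alone,
  greatest fixpoints are served too, with \<open>Mu y \<phi>\<close> standing in for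
  \<open>Nu y \<phi>\<close>.\<close>

lemma msubst_safe_unfold:
  assumes "msubst_safe X \<sigma> (Mu y \<phi>)"
    and "\<And>z. z \<in> X \<union> {y} \<Longrightarrow> free_for {} z \<phi>"
    and "fv \<theta> = fv (msubst \<sigma> (Mu y \<phi>))"
  shows "msubst_safe (X \<union> {y}) (\<sigma>(y := \<theta>)) \<phi>"
    and "subst \<theta> y (msubst (\<sigma>(y := Var y)) \<phi>) = msubst (\<sigma>(y := \<theta>)) \<phi>"
proof -
  have id: "\<sigma> z = Var z" if "z \<notin> X" for z
    using assms(1) that by (simp add: msubst_safe_def)
  have disj: "insert y (bv \<phi>) \<inter> (\<Union>z\<in>fv \<phi> - {y}. fv (\<sigma> z)) = {}"
    using assms(1) by (simp add: msubst_safe_def)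
  have "free_for {} z (Mu y \<phi>) \<or> \<sigma> z = Var z" for z
    using assms(2)[of z] id[of z] by auto
  from fv_msubst[OF this] have "fv \<theta> \<subseteq> (\<Union>z\<in>fv \<phi> - {y}. fv (\<sigma> z))"
    by (simp add: assms(3))
  with id disj show "msubst_safe (X \<union> {y}) (\<sigma>(y := \<theta>)) \<phi>"
    by (fastforce simp: msubst_safe_def split: if_splits)
  show "subst \<theta> y (msubst (\<sigma>(y := Var y)) \<phi>) = msubst (\<sigma>(y := \<theta>)) \<phi>"
    using disj by (intro subst_msubst) auto
qed

lemma Con_free_for: "Con X \<phi> \<Longrightarrow> x \<in> X \<Longrightarrow> free_for {} x \<phi>"
  by (rule free_for_Con_Cocon(2)) auto

lemma Cocon_free_for: "Cocon X \<phi> \<Longrightarrow> x \<in> X \<Longrightarrow> free_for {} x \<phi>"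
  by (rule free_for_Con_Cocon(3)) auto

section \<open>Filtrations preserve truth\<close>

lemma FL_closedD:
  assumes "FL_closed \<Sigma>"
  shows "NVar p \<in> \<Sigma> \<Longrightarrow> Var p \<in> \<Sigma>"
    and "Or \<phi> \<psi> \<in> \<Sigma> \<Longrightarrow> \<phi> \<in> \<Sigma>" "Or \<phi> \<psi> \<in> \<Sigma> \<Longrightarrow> \<psi> \<in> \<Sigma>"
    and "And \<phi> \<psi> \<in> \<Sigma> \<Longrightarrow> \<phi> \<in> \<Sigma>" "And \<phi> \<psi> \<in> \<Sigma> \<Longrightarrow> \<psi> \<in> \<Sigma>"
    and "Dia \<phi> \<in> \<Sigma> \<Longrightarrow> \<phi> \<in> \<Sigma>" "Box \<phi> \<in> \<Sigma> \<Longrightarrow> \<phi> \<in> \<Sigma>"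
    and "Mu x \<phi> \<in> \<Sigma> \<Longrightarrow> subst (Mu x \<phi>) x \<phi> \<in> \<Sigma>"
    and "Nu x \<phi> \<in> \<Sigma> \<Longrightarrow> subst (Nu x \<phi>) x \<phi> \<in> \<Sigma>"
  using FL.intros[where \<Phi> = \<Sigma>] unfolding assms[unfolded FL_closed_def] by blast+

text \<open>Interpreted twice in the final theorem, for the given data and for their duals.\<close>

locale filtered_model =
  fixes \<Sigma> :: "'p fm set"
    and M :: "('a, 'p) kripke"
    and N :: "('a set, 'p) kripke"
  assumes FL_closed: "FL_closed \<Sigma>"
    and mucML: "\<phi> \<in> \<Sigma> \<Longrightarrow> mucML \<phi>"
    and tidy: "\<phi> \<in> \<Sigma> \<Longrightarrow> tidy \<phi>"
    and kripke_M: "kripke_model M"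
    and filtration: "filtration \<Sigma> M N"
begin

abbreviation cls :: "'a \<Rightarrow> 'a set" where
  "cls \<equiv> filt_class \<Sigma> M"

lemmas closedD = FL_closedD[OF FL_closed]

lemma kripke_N: "kripke_model N"
  using filtration by (simp add: filtration_def)

lemma cls_in_states: "s \<in> states M \<Longrightarrow> cls s \<in> states N"
  using filtration by (auto simp: filtration_def filt_class_def intro: quotientI)

lemma cls_eqD:
  assumes "cls s = cls t" "s \<in> states M" "\<phi> \<in> \<Sigma>"
  shows "s \<in> sem \<phi> M \<longleftrightarrow> t \<in> sem \<phi> M"
proof -
  have "s \<in> cls s"
    using assms(2) by (simp add: filt_class_def filt_eq_def)
  then have "s \<in> cls t"
    using assms(1) by simp
  then show ?thesis
    using assms(3) by (auto simp: filt_class_def filt_eq_def sat_def)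
qed

text \<open>The lower bound \<open>filt_min\<close> makes \<open>cls\<close> a homomorphism, which
  carries diamonds over.\<close>

lemma cls_rel:
  assumes "(s, t) \<in> rel M"
  shows "(cls s, cls t) \<in> rel N"
proof -
  have "s \<in> states M" "t \<in> states M"
    using assms kripke_M by (auto simp: kripke_model_def)
  then have "(cls s, cls t) \<in> filt_min \<Sigma> M"
    using assms by (auto simp: filt_min_def filt_eq_def)
  then show ?thesis
    using filtration by (auto simp: filtration_def)
qed

lemma rel_Box:
  assumes "(cls s, v) \<in> rel N" "s \<in> sem (Box \<phi>) M" "Box \<phi> \<in> \<Sigma>"
  obtains t where "t \<in> sem \<phi> M" "v = cls t"
proof -
  have "(cls s, v) \<in> filt_max \<Sigma> M"
    using assms(1) filtration by (auto simp: filtration_def)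
  \<comment> \<open>The edge comes with its own representatives; the box moves from \<open>s\<close>
    to \<open>s'\<close> because it belongs to \<Sigma>.\<close>
  then obtain s' t where st: "cls s = cls s'" "v = cls t"
    and box: "\<And>\<phi>. Box \<phi> \<in> \<Sigma> \<Longrightarrow> s' \<in> sem (Box \<phi>) M \<Longrightarrow> t \<in> sem \<phi> M"
    unfolding filt_max_def sat_def by blast
  have "s \<in> states M"
    using assms(2) by simp
  then have "s' \<in> sem (Box \<phi>) M"
    using cls_eqD st(1) assms(2,3) by blast
  with box assms(3) st(2) show thesis
    by (intro that[of t]) auto
qed

lemma cls_val:
  assumes "Var p \<in> \<Sigma>" "s \<in> states M"
  shows "cls s \<in> val N p \<longleftrightarrow> s \<in> val M p"
proof -
  have "val N p = {cls s | s. s \<in> states M \<and> s \<in> sem (Var p) M}"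
    using filtration assms(1) by (simp add: filtration_def sat_def)
  then show ?thesis
    using cls_eqD[OF _ assms(2,1)] assms(2) unfolding sem.simps by blast
qed

section \<open>Fixpoints over reinterpreted active variables\<close>

definition variant :: "'p set \<Rightarrow> ('b, 'p) kripke \<Rightarrow> ('b, 'p) kripke \<Rightarrow> bool" where
  "variant X K K' \<longleftrightarrow> kripke_model K' \<and> states K' = states K \<and> rel K' = rel K \<and>
     (\<forall>p. p \<notin> X \<longrightarrow> val K' p = val K p)"

lemma variant_upd:
  "variant X K K' \<Longrightarrow> A \<subseteq> states K \<Longrightarrow> variant (X \<union> {y}) K (upd K' y A)"
  by (auto simp: variant_def kripke_model_upd)

lemma variant_sem: "variant X K K' \<Longrightarrow> fv \<phi> \<inter> X = {} \<Longrightarrow> sem \<phi> K' = sem \<phi> K"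
  by (rule sem_cong) (auto simp: variant_def)

lemma cls_sem_Mu:
  assumes "variant X M M'" "variant X N N'"
    and step: "\<And>A B. A \<subseteq> states M \<Longrightarrow> B \<subseteq> states N \<Longrightarrow> cls ` A \<subseteq> B \<Longrightarrow>
      cls ` sem \<phi> (upd M' y A) \<subseteq> sem \<phi> (upd N' y B)"
  shows "cls ` sem (Mu y \<phi>) M' \<subseteq> sem (Mu y \<phi>) N'"
proof -
  have "cls ` sem (Mu y \<phi>) M' \<subseteq> Z"
    if Z: "Z \<subseteq> states N" "sem \<phi> (upd N' y Z) \<subseteq> Z" for Z
  proof -
    \<comment> \<open>The largest set of states of \<open>M\<close> that \<open>cls\<close> maps
      into \<open>Z\<close>; \<open>step\<close> at \<open>T\<close> and \<open>Z\<close> shows that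
      it is a prefixpoint in \<open>M'\<close>.\<close>
    define T where "T = {t \<in> states M. cls t \<in> Z}"
    have "variant (X \<union> {y}) M (upd M' y T)"
      using assms(1) by (intro variant_upd) (auto simp: T_def)
    then have "sem \<phi> (upd M' y T) \<subseteq> states M"
      using sem_subset_states[of "upd M' y T" \<phi>] by (simp add: variant_def)
    moreover have "cls ` sem \<phi> (upd M' y T) \<subseteq> Z"
      using step[of T Z] Z by (auto simp: T_def)
    ultimately have "sem \<phi> (upd M' y T) \<subseteq> T"
      by (auto simp: T_def)
    moreover have "T \<subseteq> states M'"
      using assms(1) by (auto simp: T_def variant_def)
    ultimately have "sem (Mu y \<phi>) M' \<subseteq> T"
      unfolding sem.simps by (intro Inter_lower) simp
    then show ?thesis
      by (auto simp: T_def)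
  qed
  then show ?thesis
    using assms(2) unfolding sem.simps(7)[of y \<phi> N']
    by (intro Inter_greatest) (simp add: variant_def)
qed

text \<open>In use, \<psi> is \<phi> with the active variables replaced: it is evaluated in
  \<open>M\<close> itself, whereas \<phi> reads these variables off \<open>N'\<close>. Unfolding
  \<open>Nu y \<psi>\<close> once in \<open>M\<close> makes the image of its truth set a
  postfixpoint in \<open>N'\<close>.\<close>

lemma cls_sem_Nu:
  assumes "variant X N N'" "Nu y \<psi> \<in> \<Sigma>"
    and step: "\<And>B. B \<subseteq> states N \<Longrightarrow> cls ` sem (Nu y \<psi>) M \<subseteq> B \<Longrightarrow>
      cls ` sem (subst (Nu y \<psi>) y \<psi>) M \<subseteq> sem \<phi> (upd N' y B)"
  shows "cls ` sem (Nu y \<psi>) M \<subseteq> sem (Nu y \<phi>) N'"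
proof -
  define B where "B = cls ` sem (Nu y \<psi>) M"
  have B: "B \<subseteq> states N"
    using cls_in_states sem_subset_states[OF kripke_M, of "Nu y \<psi>"] unfolding B_def by blast
  have "B \<subseteq> cls ` sem (subst (Nu y \<psi>) y \<psi>) M"
    unfolding B_def by (intro image_mono sem_Nu_unfold mucML tidy assms(2))
  also have "\<dots> \<subseteq> sem \<phi> (upd N' y B)"
    by (rule step[OF B]) (simp only: B_def order_refl)
  finally have "B \<subseteq> sem (Nu y \<phi>) N'"
    using B assms(1) unfolding sem.simps by (intro Union_upper) (simp add: variant_def)
  then show ?thesis by (simp only: B_def)
qed

text \<open>The two classes are treated differently. For \<open>Con\<close> the active variables
  denote related sets in \<open>M'\<close> and \<open>N'\<close>, and \<sigma> only keeps track of
  which instances lie in \<Sigma>. For \<open>Cocon\<close> the instance itself is evaluated in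
  \<open>M\<close>, because \<open>rel_Box\<close> needs a box that belongs to \<Sigma>. \<sigma>
  and the variants are quantified since they change at nested binders.\<close>

lemma cls_sem:
  "mucML \<phi> \<Longrightarrow> \<phi> \<in> \<Sigma> \<longrightarrow> cls ` sem \<phi> M \<subseteq> sem \<phi> N"
  "Con X \<phi> \<Longrightarrow> \<forall>\<sigma> M' N'. msubst_safe X \<sigma> \<phi> \<longrightarrow> msubst \<sigma> \<phi> \<in> \<Sigma> \<longrightarrow>
     variant X M M' \<longrightarrow> variant X N N' \<longrightarrow> (\<forall>x\<in>X. cls ` val M' x \<subseteq> val N' x) \<longrightarrow>
     cls ` sem \<phi> M' \<subseteq> sem \<phi> N'"
  "Cocon X \<phi> \<Longrightarrow> \<forall>\<sigma> N'. msubst_safe X \<sigma> \<phi> \<longrightarrow> msubst \<sigma> \<phi> \<in> \<Sigma> \<longrightarrow>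
     variant X N N' \<longrightarrow> (\<forall>x\<in>X. cls ` sem (\<sigma> x) M \<subseteq> val N' x) \<longrightarrow>
     cls ` sem (msubst \<sigma> \<phi>) M \<subseteq> sem \<phi> N'"
proof (induction rule: mucML_Con_Cocon.inducts)
  case (mucML_Var p)
  then show ?case
    using cls_val kripke_M by (auto simp: kripke_model_def subset_iff)
next
  case (mucML_NVar p)
  then show ?case
    using cls_val closedD(1) cls_in_states by auto
next
  case (mucML_Or \<phi> \<psi>)
  then show ?case
    by (auto simp: image_subset_iff dest: closedD(2,3))
next
  case (mucML_And \<phi> \<psi>)
  then show ?case
    by (auto simp: image_subset_iff dest: closedD(4,5))
next
  case (mucML_Dia \<phi>)
  then have "cls ` sem \<phi> M \<subseteq> sem \<phi> N" if "Dia \<phi> \<in> \<Sigma>"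
    using that by (blast dest: closedD(6))
  then show ?case
    using cls_in_states cls_rel unfolding sem.simps by blast
next
  case (mucML_Box \<phi>)
  show ?case
  proof
    assume box: "Box \<phi> \<in> \<Sigma>"
    show "cls ` sem (Box \<phi>) M \<subseteq> sem (Box \<phi>) N"
    proof (rule image_subsetI)
      fix s
      assume s: "s \<in> sem (Box \<phi>) M"
      have "v \<in> sem \<phi> N" if "(cls s, v) \<in> rel N" for v
        by (rule rel_Box[OF that s box]) (use mucML_Box.IH closedD(7)[OF box] in auto)
      then show "cls s \<in> sem (Box \<phi>) N"
        using s cls_in_states by simp
    qed
  qed
next
  case (mucML_Mu x \<phi>)
  show ?case
  proof
    assume Mu: "Mu x \<phi> \<in> \<Sigma>"
    define \<theta> where "\<theta> = Mu x \<phi>"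
    \<comment> \<open>Tidiness starts the invariant, with no active variables and the identity
      substitution.\<close>
    have safe: "msubst_safe {} Var (Mu x \<phi>)"
      using tidy[OF Mu] by (simp add: msubst_safe_def tidy_def) blast
    have unf: "msubst_safe ({} \<union> {x}) (Var(x := \<theta>)) \<phi>"
      "subst \<theta> x (msubst (Var(x := Var x)) \<phi>) = msubst (Var(x := \<theta>)) \<phi>"
      using msubst_safe_unfold[OF safe, of \<theta>] Con_free_for[OF mucML_Mu.hyps]
      by (simp_all add: \<theta>_def msubst_ident)
    have mem: "msubst (Var(x := \<theta>)) \<phi> \<in> \<Sigma>"
      using closedD(8)[OF Mu] unf(2) by (simp add: msubst_ident \<theta>_def)
    have var: "variant {} M M" "variant {} N N"
      by (simp_all add: variant_def kripke_M kripke_N)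
    show "cls ` sem (Mu x \<phi>) M \<subseteq> sem (Mu x \<phi>) N"
    proof (rule cls_sem_Mu[OF var])
      fix A B
      assume "A \<subseteq> states M" "B \<subseteq> states N" "cls ` A \<subseteq> B"
      then show "cls ` sem \<phi> (upd M x A) \<subseteq> sem \<phi> (upd N x B)"
        using mucML_Mu.IH unf(1) mem variant_upd[OF var(1), of A x] variant_upd[OF var(2), of B x]
        by auto
    qed
  qed
next
  case (mucML_Nu x \<phi>)
  show ?case
  proof
    assume Nu: "Nu x \<phi> \<in> \<Sigma>"
    define \<theta> where "\<theta> = Nu x \<phi>"
    have safe: "msubst_safe {} Var (Mu x \<phi>)"
      using tidy[OF Nu] by (simp add: msubst_safe_def tidy_def) blast
    have unf: "msubst_safe ({} \<union> {x}) (Var(x := \<theta>)) \<phi>"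
      "subst \<theta> x (msubst (Var(x := Var x)) \<phi>) = msubst (Var(x := \<theta>)) \<phi>"
      using msubst_safe_unfold[OF safe, of \<theta>] Cocon_free_for[OF mucML_Nu.hyps]
      by (simp_all add: \<theta>_def msubst_ident)
    have eq: "subst \<theta> x \<phi> = msubst (Var(x := \<theta>)) \<phi>"
      using unf(2) by (simp add: msubst_ident)
    have mem: "msubst (Var(x := \<theta>)) \<phi> \<in> \<Sigma>"
      using closedD(9)[OF Nu] eq by (simp add: \<theta>_def)
    have var: "variant {} N N"
      by (simp add: variant_def kripke_N)
    show "cls ` sem (Nu x \<phi>) M \<subseteq> sem (Nu x \<phi>) N"
    proof (rule cls_sem_Nu[OF var Nu])
      fix B
      assume "B \<subseteq> states N" "cls ` sem (Nu x \<phi>) M \<subseteq> B"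
      then have "cls ` sem (msubst (Var(x := \<theta>)) \<phi>) M \<subseteq> sem \<phi> (upd N x B)"
        using mucML_Nu.IH unf(1) mem variant_upd[OF var, of B x]
        by (auto simp del: sem.simps simp: \<theta>_def)
      then show "cls ` sem (subst (Nu x \<phi>) x \<phi>) M \<subseteq> sem \<phi> (upd N x B)"
        using eq by (simp add: \<theta>_def)
    qed
  qed
next
  case (Con_Var x X)
  then show ?case by simp
next
  case (Con_free \<alpha> X)
  \<comment> \<open>As \<sigma> moves only active variables, \<alpha> itself lies in \<Sigma>; the
    variants agree with the original models on it, so the hypothesis for \<open>mucML\<close>
    applies.\<close>
  have "msubst \<sigma> \<alpha> = \<alpha>" if "msubst_safe X \<sigma> \<alpha>" for \<sigma>
    using that Con_free.hyps by (intro msubst_ident) (auto simp: msubst_safe_def)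
  then show ?case
    using Con_free variant_sem by metis
next
  case (Con_Or X \<phi> \<psi>)
  have "msubst_safe X \<sigma> \<phi> \<and> msubst_safe X \<sigma> \<psi>" if "msubst_safe X \<sigma> (Or \<phi> \<psi>)" for \<sigma>
    using that by (auto simp: msubst_safe_def)
  then show ?case
    using Con_Or.IH by (simp add: image_subset_iff) (blast dest: closedD(2,3))
next
  case (Con_And X \<phi> \<psi>)
  have "msubst_safe X \<sigma> \<phi> \<and> msubst_safe X \<sigma> \<psi>" if "msubst_safe X \<sigma> (And \<phi> \<psi>)" for \<sigma>
    using that by (auto simp: msubst_safe_def)
  then show ?case
    using Con_And.IH by (simp add: image_subset_iff) (blast dest: closedD(4,5))
next
  case (Con_Dia X \<phi>)
  show ?case
  proof (intro allI impI)
    fix \<sigma> M' N'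
    assume *: "msubst_safe X \<sigma> (Dia \<phi>)" "msubst \<sigma> (Dia \<phi>) \<in> \<Sigma>" "variant X M M'" "variant X N N'"
      "\<forall>x\<in>X. cls ` val M' x \<subseteq> val N' x"
    have "cls ` sem \<phi> M' \<subseteq> sem \<phi> N'"
      using Con_Dia.IH * closedD(6) by (simp add: msubst_safe_def)
    then show "cls ` sem (Dia \<phi>) M' \<subseteq> sem (Dia \<phi>) N'"
      using *(3,4) cls_in_states cls_rel by (simp add: variant_def image_subset_iff) blast
  qed
next
  case (Con_Mu X y \<phi>)
  show ?case
  proof (intro allI impI)
    fix \<sigma> M' N'
    assume *: "msubst_safe X \<sigma> (Mu y \<phi>)" "msubst \<sigma> (Mu y \<phi>) \<in> \<Sigma>" "variant X M M'" "variant X N N'"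
      "\<forall>x\<in>X. cls ` val M' x \<subseteq> val N' x"
    define \<theta> where "\<theta> = msubst \<sigma> (Mu y \<phi>)"
    have unf: "msubst_safe (X \<union> {y}) (\<sigma>(y := \<theta>)) \<phi>"
      "subst \<theta> y (msubst (\<sigma>(y := Var y)) \<phi>) = msubst (\<sigma>(y := \<theta>)) \<phi>"
      using msubst_safe_unfold[OF *(1), of \<theta>] Con_free_for[OF Con_Mu.hyps]
      by (simp_all add: \<theta>_def)
    \<comment> \<open>Closure puts the unfolding of \<theta> into \<Sigma>, and this unfolding is
      the instance of the body with \<theta> for \<open>y\<close>.\<close>
    have mem: "msubst (\<sigma>(y := \<theta>)) \<phi> \<in> \<Sigma>"
      using closedD(8)[OF *(2)[unfolded msubst.simps]] unf(2) by (simp add: \<theta>_def)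
    show "cls ` sem (Mu y \<phi>) M' \<subseteq> sem (Mu y \<phi>) N'"
    proof (rule cls_sem_Mu[OF *(3,4)])
      fix A B
      assume A: "A \<subseteq> states M" and B: "B \<subseteq> states N" and "cls ` A \<subseteq> B"
      then have "\<forall>x\<in>X \<union> {y}. cls ` val (upd M' y A) x \<subseteq> val (upd N' y B) x"
        using *(5) by simp
      with Con_Mu.IH[rule_format, OF unf(1) mem variant_upd[OF *(3) A] variant_upd[OF *(4) B]]
      show "cls ` sem \<phi> (upd M' y A) \<subseteq> sem \<phi> (upd N' y B)"
        by blast
    qed
  qed
next
  case (Cocon_Var x X)
  then show ?case by simp
next
  case (Cocon_free \<alpha> X)
  have "msubst \<sigma> \<alpha> = \<alpha>" if "msubst_safe X \<sigma> \<alpha>" for \<sigma>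
    using that Cocon_free.hyps by (intro msubst_ident) (auto simp: msubst_safe_def)
  then show ?case
    using Cocon_free variant_sem by metis
next
  case (Cocon_Or X \<phi> \<psi>)
  have "msubst_safe X \<sigma> \<phi> \<and> msubst_safe X \<sigma> \<psi>" if "msubst_safe X \<sigma> (Or \<phi> \<psi>)" for \<sigma>
    using that by (auto simp: msubst_safe_def)
  then show ?case
    using Cocon_Or.IH by (simp add: image_subset_iff) (blast dest: closedD(2,3))
next
  case (Cocon_And X \<phi> \<psi>)
  have "msubst_safe X \<sigma> \<phi> \<and> msubst_safe X \<sigma> \<psi>" if "msubst_safe X \<sigma> (And \<phi> \<psi>)" for \<sigma>
    using that by (auto simp: msubst_safe_def)
  then show ?case
    using Cocon_And.IH by (simp add: image_subset_iff) (blast dest: closedD(4,5))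
next
  case (Cocon_Box X \<phi>)
  show ?case
  proof (intro allI impI image_subsetI)
    fix \<sigma> N' s
    assume *: "msubst_safe X \<sigma> (Box \<phi>)" "msubst \<sigma> (Box \<phi>) \<in> \<Sigma>" "variant X N N'"
      "\<forall>x\<in>X. cls ` sem (\<sigma> x) M \<subseteq> val N' x" "s \<in> sem (msubst \<sigma> (Box \<phi>)) M"
    have IH: "cls ` sem (msubst \<sigma> \<phi>) M \<subseteq> sem \<phi> N'"
      using Cocon_Box.IH * closedD(7) by (simp add: msubst_safe_def)
    \<comment> \<open>The instance of the box is in \<Sigma> and holds at \<open>s\<close>, so
      \<open>v\<close> is the class of a state satisfying the instance of \<phi>, even if
      \<open>s\<close> has no edge to that state.\<close>
    have "v \<in> sem \<phi> N'" if "(cls s, v) \<in> rel N" for v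
      by (rule rel_Box[OF that, of "msubst \<sigma> \<phi>"]) (use *(2,5) IH in auto)
    then show "cls s \<in> sem (Box \<phi>) N'"
      using *(3,5) cls_in_states by (simp add: variant_def)
  qed
next
  case (Cocon_Nu X y \<phi>)
  show ?case
  proof (intro allI impI)
    fix \<sigma> N'
    assume *: "msubst_safe X \<sigma> (Nu y \<phi>)" "msubst \<sigma> (Nu y \<phi>) \<in> \<Sigma>" "variant X N N'"
      "\<forall>x\<in>X. cls ` sem (\<sigma> x) M \<subseteq> val N' x"
    define \<psi> where "\<psi> = msubst (\<sigma>(y := Var y)) \<phi>"
    define \<theta> where "\<theta> = Nu y \<psi>"
    have safe: "msubst_safe X \<sigma> (Mu y \<phi>)"
      using *(1) by (simp add: msubst_safe_def)
    have unf: "msubst_safe (X \<union> {y}) (\<sigma>(y := \<theta>)) \<phi>" "subst \<theta> y \<psi> = msubst (\<sigma>(y := \<theta>)) \<phi>"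
      using msubst_safe_unfold[OF safe, of \<theta>] Cocon_free_for[OF Cocon_Nu.hyps]
      by (simp_all add: \<theta>_def \<psi>_def)
    have Nu: "Nu y \<psi> \<in> \<Sigma>"
      using *(2) by (simp add: \<psi>_def)
    have mem: "msubst (\<sigma>(y := \<theta>)) \<phi> \<in> \<Sigma>"
      using closedD(9)[OF Nu] unf(2) by (simp add: \<theta>_def)
    have "cls ` sem (Nu y \<psi>) M \<subseteq> sem (Nu y \<phi>) N'"
    proof (rule cls_sem_Nu[OF *(3) Nu])
      fix B
      assume B: "B \<subseteq> states N" "cls ` sem (Nu y \<psi>) M \<subseteq> B"
      \<comment> \<open>With \<theta> as the value of \<open>y\<close>, the invariant at
        \<open>y\<close> is the assumption that \<open>B\<close> contains the image of its truth
        set.\<close>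
      have "\<forall>x\<in>X \<union> {y}. cls ` sem ((\<sigma>(y := \<theta>)) x) M \<subseteq> val (upd N' y B) x"
        using B(2) *(4) by (simp add: \<theta>_def del: sem.simps)
      with Cocon_Nu.IH[rule_format, OF unf(1) mem variant_upd[OF *(3) B(1)]]
      have "cls ` sem (msubst (\<sigma>(y := \<theta>)) \<phi>) M \<subseteq> sem \<phi> (upd N' y B)"
        by blast
      then show "cls ` sem (subst (Nu y \<psi>) y \<psi>) M \<subseteq> sem \<phi> (upd N' y B)"
        unfolding \<theta>_def[symmetric] unf(2) .
    qed
    then show "cls ` sem (msubst \<sigma> (Nu y \<phi>)) M \<subseteq> sem (Nu y \<phi>) N'"
      by (simp only: msubst.simps \<psi>_def)
  qed
qed

lemma sat_cls: "\<phi> \<in> \<Sigma> \<Longrightarrow> sat M s \<phi> \<Longrightarrow> sat N (cls s) \<phi>"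
  using cls_sem(1)[OF mucML, of \<phi>] by (auto simp: sat_def)

end

section \<open>Duality\<close>

text \<open>Literals stay as they are, their negation being absorbed by \<open>compl_model\<close>;
  thus bound variables stay positive and \<open>dual\<close> commutes with
  \<open>subst\<close>.\<close>

primrec dual :: "'p fm \<Rightarrow> 'p fm" where
  "dual (Var p) = Var p"
| "dual (NVar p) = NVar p"
| "dual (Or \<phi> \<psi>) = And (dual \<phi>) (dual \<psi>)"
| "dual (And \<phi> \<psi>) = Or (dual \<phi>) (dual \<psi>)"
| "dual (Dia \<phi>) = Box (dual \<phi>)"
| "dual (Box \<phi>) = Dia (dual \<phi>)"
| "dual (Mu x \<phi>) = Nu x (dual \<phi>)"
| "dual (Nu x \<phi>) = Mu x (dual \<phi>)"

definition compl_model :: "('a, 'p) kripke \<Rightarrow> ('a, 'p) kripke" where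
  "compl_model M = M\<lparr>val := \<lambda>p. states M - val M p\<rparr>"

lemma dual_dual [simp]: "dual (dual \<phi>) = \<phi>"
  by (induction \<phi>) auto

lemma fv_dual [simp]: "fv (dual \<phi>) = fv \<phi>"
  by (induction \<phi>) auto

lemma bv_dual [simp]: "bv (dual \<phi>) = bv \<phi>"
  by (induction \<phi>) auto

lemma dual_subst: "dual (subst \<theta> x \<phi>) = subst (dual \<theta>) x (dual \<phi>)"
  by (induction \<phi>) auto

lemma tidy_dual [simp]: "tidy (dual \<phi>) \<longleftrightarrow> tidy \<phi>"
  by (simp add: tidy_def)

lemma mucML_dual:
  "mucML \<phi> \<Longrightarrow> mucML (dual \<phi>)"
  "Con X \<phi> \<Longrightarrow> Cocon X (dual \<phi>)"
  "Cocon X \<phi> \<Longrightarrow> Con X (dual \<phi>)"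
  by (induction rule: mucML_Con_Cocon.inducts) (auto intro: mucML_Con_Cocon.intros simp: Con_free Cocon_free)

lemma FL_closed_dual:
  assumes "FL_closed \<Sigma>"
  shows "FL_closed (dual ` \<Sigma>)"
proof -
  have mem: "\<psi> \<in> dual ` \<Sigma> \<longleftrightarrow> dual \<psi> \<in> \<Sigma>" for \<psi>
    by (metis dual_dual image_iff)
  have "\<phi> \<in> dual ` \<Sigma>" if "\<phi> \<in> FL (dual ` \<Sigma>)" for \<phi>
    using that
    by (induction rule: FL.induct) (auto simp: mem dual_subst dest: FL_closedD[OF assms])
  then show ?thesis
    unfolding FL_closed_def using FL_base by blast
qed

section \<open>Complementary models\<close>

lemma compl_model_simps [simp]:
  "states (compl_model M) = states M"
  "rel (compl_model M) = rel M"
  "val (compl_model M) p = states M - val M p"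
  by (simp_all add: compl_model_def)

lemma kripke_compl_model: "kripke_model M \<Longrightarrow> kripke_model (compl_model M)"
  by (auto simp: kripke_model_def)

lemma upd_compl_model:
  "X \<subseteq> states M \<Longrightarrow> upd (compl_model M) x X = compl_model (upd M x (states M - X))"
  by (simp add: upd_def compl_model_def fun_eq_iff double_diff)

text \<open>At a fixpoint, complementation within \<open>states M\<close> exchanges the prefixpoints
  of one body with the postfixpoints of the other.\<close>

lemma sem_dual: "kripke_model M \<Longrightarrow> sem (dual \<phi>) (compl_model M) = states M - sem \<phi> M"
proof (induction \<phi> arbitrary: M)
  case (Dia \<phi>)
  then show ?case by (auto simp: kripke_model_def)
next
  case (Box \<phi>)
  then show ?case by (auto simp: kripke_model_def)
next
  case (Mu x \<phi>)
  have *: "sem (dual \<phi>) (upd (compl_model M) x X) = states M - sem \<phi> (upd M x (states M - X))"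
    if "X \<subseteq> states M" for X
    using that Mu.IH[OF kripke_model_upd[OF Mu.prems, of "states M - X" x]]
    by (simp add: upd_compl_model)
  \<comment> \<open>Ensures that a truth set disjoint from \<open>X\<close> lies in the complement
    of \<open>X\<close>.\<close>
  have sub: "sem \<phi> (upd M x X) \<subseteq> states M" if "X \<subseteq> states M" for X
    using sem_subset_states[OF kripke_model_upd[OF Mu.prems that]] by simp
  show ?case
  proof (rule set_eqI)
    fix s
    have "s \<in> sem (dual (Mu x \<phi>)) (compl_model M) \<longleftrightarrow>
      (\<exists>X. X \<subseteq> states M \<and> X \<subseteq> states M - sem \<phi> (upd M x (states M - X)) \<and> s \<in> X)"
      by (auto simp: * cong: conj_cong)
    also have "\<dots> \<longleftrightarrow>
      (\<exists>Z. Z \<subseteq> states M \<and> sem \<phi> (upd M x Z) \<subseteq> Z \<and> s \<in> states M - Z)" (is "?L \<longleftrightarrow> ?R")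
    proof
      assume ?L
      then obtain X where "X \<subseteq> states M" "X \<subseteq> states M - sem \<phi> (upd M x (states M - X))" "s \<in> X"
        by blast
      then show ?R
        using sub[of "states M - X"] by (intro exI[of _ "states M - X"]) auto
    next
      assume ?R
      then obtain Z where "Z \<subseteq> states M" "sem \<phi> (upd M x Z) \<subseteq> Z" "s \<in> states M - Z"
        by blast
      then show ?L
        by (intro exI[of _ "states M - Z"]) (auto simp: double_diff)
    qed
    finally show "s \<in> sem (dual (Mu x \<phi>)) (compl_model M) \<longleftrightarrow> s \<in> states M - sem (Mu x \<phi>) M"
      using sub[of "states M"] by auto
  qed
next
  case (Nu x \<phi>)
  have *: "sem (dual \<phi>) (upd (compl_model M) x X) = states M - sem \<phi> (upd M x (states M - X))"
    if "X \<subseteq> states M" for X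
    using that Nu.IH[OF kripke_model_upd[OF Nu.prems, of "states M - X" x]]
    by (simp add: upd_compl_model)
  show ?case
  proof (rule set_eqI)
    fix s
    have "s \<in> sem (dual (Nu x \<phi>)) (compl_model M) \<longleftrightarrow>
      (\<forall>X. X \<subseteq> states M \<and> states M - sem \<phi> (upd M x (states M - X)) \<subseteq> X \<longrightarrow> s \<in> X)"
      by (auto simp: * cong: conj_cong)
    also have "\<dots> \<longleftrightarrow> s \<in> states M \<and>
      (\<forall>Z. Z \<subseteq> states M \<and> Z \<subseteq> sem \<phi> (upd M x Z) \<longrightarrow> s \<in> states M - Z)" (is "?L \<longleftrightarrow> ?R")
    proof
      assume L: ?L
      show ?R
      proof (intro conjI allI impI)
        \<comment> \<open>\<open>states M\<close> trivially satisfies the premise of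
          \<open>L\<close>, which yields the membership.\<close>
        show "s \<in> states M"
          using L[rule_format, of "states M"] by auto
        fix Z
        assume "Z \<subseteq> states M \<and> Z \<subseteq> sem \<phi> (upd M x Z)"
        then show "s \<in> states M - Z"
          using L[rule_format, of "states M - Z"] by (auto simp: double_diff)
      qed
    next
      assume R: ?R
      show ?L
      proof (intro allI impI)
        fix X
        assume "X \<subseteq> states M \<and> states M - sem \<phi> (upd M x (states M - X)) \<subseteq> X"
        then show "s \<in> X"
          using conjunct2[OF R, rule_format, of "states M - X"] conjunct1[OF R] by auto
      qed
    qed
    finally show "s \<in> sem (dual (Nu x \<phi>)) (compl_model M) \<longleftrightarrow> s \<in> states M - sem (Nu x \<phi>) M"
      by auto
  qed
qed auto

section \<open>Dual filtrations\<close>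

lemma sat_dual:
  "kripke_model M \<Longrightarrow> sat (compl_model M) s (dual \<phi>) \<longleftrightarrow> s \<in> states M \<and> \<not> sat M s \<phi>"
  by (simp add: sat_def sem_dual)

text \<open>Within \<open>states M\<close>, dual formulas hold exactly where the originals fail, so
  agreement on the duals is agreement on \<Sigma>.\<close>

lemma filt_eq_dual: "kripke_model M \<Longrightarrow> filt_eq (dual ` \<Sigma>) (compl_model M) = filt_eq \<Sigma> M"
  by (auto simp: filt_eq_def sat_dual)

lemma filt_class_dual: "kripke_model M \<Longrightarrow> filt_class (dual ` \<Sigma>) (compl_model M) = filt_class \<Sigma> M"
  by (simp add: fun_eq_iff filt_class_def filt_eq_dual)

lemma filt_min_dual: "kripke_model M \<Longrightarrow> filt_min (dual ` \<Sigma>) (compl_model M) = filt_min \<Sigma> M"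
  by (simp add: filt_min_def filt_eq_dual filt_class_dual)

text \<open>Contraposition turns the \<open>Box\<close> clause for the duals into the
  \<open>Dia\<close> clause for \<Sigma> and vice versa, so the pair of clauses is
  self-dual.\<close>

lemma filt_max_dual:
  assumes "kripke_model M"
  shows "filt_max (dual ` \<Sigma>) (compl_model M) = filt_max \<Sigma> M"
proof -
  have mem: "\<psi> \<in> dual ` \<Sigma> \<longleftrightarrow> dual \<psi> \<in> \<Sigma>" for \<psi>
    by (metis dual_dual image_iff)
  have sat: "sat (compl_model M) s \<phi> \<longleftrightarrow> s \<in> states M \<and> \<not> sat M s (dual \<phi>)" for s \<phi>
    using sat_dual[OF assms, of s "dual \<phi>"] by simp
  have "(\<forall>\<phi>. Box \<phi> \<in> dual ` \<Sigma> \<longrightarrow> sat (compl_model M) s (Box \<phi>) \<longrightarrow> sat (compl_model M) t \<phi>) \<longleftrightarrow>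
      (\<forall>\<phi>. Dia \<phi> \<in> \<Sigma> \<longrightarrow> sat M t \<phi> \<longrightarrow> sat M s (Dia \<phi>))"
    "(\<forall>\<phi>. Dia \<phi> \<in> dual ` \<Sigma> \<longrightarrow> sat (compl_model M) t \<phi> \<longrightarrow> sat (compl_model M) s (Dia \<phi>)) \<longleftrightarrow>
      (\<forall>\<phi>. Box \<phi> \<in> \<Sigma> \<longrightarrow> sat M s (Box \<phi>) \<longrightarrow> sat M t \<phi>)"
    if "s \<in> states M" "t \<in> states M" for s t
    using that by (simp_all add: mem sat) (metis dual_dual)+
  then show ?thesis
    unfolding filt_max_def filt_class_dual[OF assms] compl_model_simps by blast
qed

text \<open>Besides the two bounds, the valuation has to be complemented: truth of
  \<open>Var p\<close> is constant on classes, so the classes outside \<open>val N p\<close> are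
  those of the states where \<open>p\<close> fails.\<close>

lemma filtration_dual:
  assumes "kripke_model M" "filtration \<Sigma> M N"
  shows "filtration (dual ` \<Sigma>) (compl_model M) (compl_model N)"
proof -
  let ?cls = "filt_class \<Sigma> M"
  have val: "val (compl_model N) p = {?cls s | s. s \<in> states M \<and> \<not> sat M s (Var p)}"
    if p: "Var p \<in> \<Sigma>" for p
  proof -
    have val_N: "val N p = {?cls s | s. s \<in> states M \<and> sat M s (Var p)}"
      using assms(2) p by (simp add: filtration_def)
    have states_N: "states N = ?cls ` states M"
      using assms(2) by (auto simp: filtration_def filt_class_def quotient_def)
    have sat_eq: "sat M s (Var p) \<longleftrightarrow> sat M t (Var p)"
      if "?cls t = ?cls s" "s \<in> states M" for s t
    proof -
      have "s \<in> ?cls s"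
        using that(2) by (simp add: filt_class_def filt_eq_def)
      then have "s \<in> ?cls t"
        using that(1) by simp
      then show ?thesis
        using p by (auto simp: filt_class_def filt_eq_def)
    qed
    have mem_val: "?cls s \<in> val N p \<longleftrightarrow> sat M s (Var p)" if "s \<in> states M" for s
      unfolding val_N using sat_eq[OF _ that] that by (smt (verit) mem_Collect_eq)
    show ?thesis
    proof (rule set_eqI)
      fix v
      have "v \<in> val (compl_model N) p \<longleftrightarrow> (\<exists>s. v = ?cls s \<and> s \<in> states M \<and> ?cls s \<notin> val N p)"
        unfolding compl_model_simps states_N by blast
      then show "v \<in> val (compl_model N) p \<longleftrightarrow> v \<in> {?cls s | s. s \<in> states M \<and> \<not> sat M s (Var p)}"
        using mem_val by (simp cong: conj_cong)
    qed
  qed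
  have sat: "sat (compl_model M) s (Var p) \<longleftrightarrow> s \<in> states M \<and> \<not> sat M s (Var p)" for s p
    using sat_dual[OF assms(1), of s "Var p"] by simp
  have mem: "Var p \<in> dual ` \<Sigma> \<longleftrightarrow> Var p \<in> \<Sigma>" for p
    by (metis dual.simps(1) dual_dual image_iff)
  have "val (compl_model N) p =
      {filt_class \<Sigma> M s | s. s \<in> states M \<and> sat (compl_model M) s (Var p)}"
    if "Var p \<in> \<Sigma>" for p
    unfolding val[OF that] sat by simp
  then show ?thesis
    using assms(2) kripke_compl_model[of N]
    unfolding filtration_def filt_eq_dual[OF assms(1)] filt_class_dual[OF assms(1)]
      filt_min_dual[OF assms(1)] filt_max_dual[OF assms(1)] mem compl_model_simps(1,2)
    by blast
qed

theorem theorem3p2: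
  fixes \<Sigma> :: "'p::{countable,infinite} fm set"
    and M :: "('a, 'p) kripke"
    and N :: "('a set, 'p) kripke"
    and s :: 'a
    and \<xi> :: "'p fm"
  assumes "finite \<Sigma>"
    and "FL_closed \<Sigma>"
    and "\<forall>\<phi>\<in>\<Sigma>. mucML \<phi>"
    and "\<forall>\<phi>\<in>\<Sigma>. tidy \<phi>"
    and "kripke_model M"
    and "filtration \<Sigma> M N"
    and "s \<in> states M"
    and "\<xi> \<in> \<Sigma>"
    and "clean \<xi>"
  shows "sat M s \<xi> \<longleftrightarrow> sat N (filt_class \<Sigma> M s) \<xi>"
proof
  interpret filtered_model \<Sigma> M N
    using assms by unfold_locales auto
  show "sat N (filt_class \<Sigma> M s) \<xi>" if "sat M s \<xi>"
    using that assms(8) by (rule sat_cls[rotated])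
  interpret co: filtered_model "dual ` \<Sigma>" "compl_model M" "compl_model N"
    using assms FL_closed_dual mucML_dual(1) kripke_compl_model filtration_dual
    by unfold_locales auto
  show "sat M s \<xi>" if "sat N (filt_class \<Sigma> M s) \<xi>"
  proof (rule ccontr)
    \<comment> \<open>Failure of \<xi> in \<open>M\<close> is truth of its dual in the complementary
      model; transferred to the same class in the complement of \<open>N\<close>, it contradicts
      \<xi> holding there in \<open>N\<close>.\<close>
    assume "\<not> sat M s \<xi>"
    then have "sat (compl_model M) s (dual \<xi>)"
      using assms(5,7) by (simp add: sat_dual)
    then have "sat (compl_model N) (filt_class \<Sigma> M s) (dual \<xi>)"
      using co.sat_cls[of "dual \<xi>" s] assms(5,8) by (simp add: filt_class_dual)
    with that show False
      using kripke_N by (simp add: sat_dual)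
  qed
qed

end
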